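(* Let $\xi_0,\xi_1,\xi_2,\ldots$ be independent and identically distributed real random variables, and suppose $\xi_0$ satisfies condition (H): there exist $M>0$ and $q\in(0,1)$ with \[ \sup_{u\in\mathbb{R}}\mathbb{P}(|\xi_0-u|\le 1)\le 1-q\quad\text{and}\quad \mathbb{P}(|\xi_0|>M)\le q/2. \] For $n\ge1$ let $\mathcal{C}_n$ be the $n\times n$ random circulant matrix whose $(i,j)$ entry, for $0\le i,j\le n-1$, is $\xi_{(j-i)\bmod n}$ (so its first row is $(\xi_0,\xi_1,\ldots,\xi_{n-1})$ and each subsequent row is the cyclic right shift of the previous one). Then for any $\varepsilon>0$ and $\rho\in(0,1/4)$, for all large $n$, \[ \mathbb{P}\left(\sigma_{\min}(\mathcal{C}_n)\le \varepsilon n^{-\rho}\right)\le C\left(\frac{\varepsilon^2+\varepsilon}{n^{2\rho}}+\frac{1}{n^{1/2-o(1)}}\right), \] where $C>0$ depends only on the distribution of $\xi_0$.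
   Context: $\sigma_{\min}(A)$ denotes the smallest singular value of a square matrix $A$, i.e. $\min_{\|x\|_2=1}\|Ax\|_2$. The notation $n^{-1/2+o(1)}$ means $n^{-1/2+\delta_n}$ for some sequence $\delta_n\to 0$ as $n\to\infty$. *)

theory Defs
  imports "HOL-Probability.Probability"
begin

text \<open>n x n real matrices are represented as functions nat => nat => real,
  only the entries with indices below n being relevant.\<close>

definition sigma_min :: "nat \<Rightarrow> (nat \<Rightarrow> nat \<Rightarrow> real) \<Rightarrow> real" where
  "sigma_min n A =
     (INF x \<in> {x :: nat \<Rightarrow> real. (\<Sum>j<n. (x j)^2) = 1 \<and> (\<forall>j\<ge>n. x j = 0)}.
        sqrt (\<Sum>i<n. (\<Sum>j<n. A i j * x j)^2))"

definition circulant :: "nat \<Rightarrow> (nat \<Rightarrow> real) \<Rightarrow> nat \<Rightarrow> nat \<Rightarrow> real" where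
  "circulant n c = (\<lambda>i j. c ((j + n - i) mod n))"

end

theory Submission
  imports Defs "HOL-Library.Real_Mod" "HOL-Number_Theory.Cong" "HOL-Real_Asymp.Real_Asymp"
begin

text \<open>
  The singular values of the circulant matrix are the moduli of
  $S_k = \sum_{j<n} \xi_j \omega^{jk}$ with $\omega = e^{2\pi i/n}$, so a union bound over $k$
  reduces the theorem to small-ball estimates for $S_k$. Let $d = n / \gcd(k, n)$ be the order of
  $\omega^k$. Esseen smoothing gives $P(|S_k| \le t) = O(t^2/n)$ as soon as the characteristic
  function of $S_k$ is at most $\exp(-cn\min(1, |\theta|^2))$ for $|\theta| = O(1/t)$, and by
  condition (H) this follows from a lower bound for
  $F(\theta) = \sum_{j<n} (1 - \cos \mathrm{Re}(\theta\omega^{jk}))$.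
  For $|\theta| \le 1$ one has $F(\theta) \ge n|\theta|^2/8$ unless $\omega^{2k} = 1$. Larger $\theta$
  are brought back to this range by $F(\theta(\omega^{mk} - 1)) \le 4F(\theta)$, where $m$ can
  be chosen with $|\theta||\omega^{mk} - 1| \in [1/4, 1]$ whenever $d \ge 2\pi|\theta|$.

  Since $\rho < 1/4$, this covers $t = \varepsilon n^{-\rho}$ for all $k$ with $d > n^{1/4}$. The at most
  $\sqrt n$ remaining $k$ with $d \ge 3$ contribute $O(1/n)$ each, by smoothing at unit scale, and the
  at most two $k$ with $d \le 2$, where $S_k$ is real, contribute $O(n^{-1/2})$ each. In particular
  the error exponent can be taken to be $\delta_n = 0$.
\<close>

section \<open>Eigenvalues of circulant matrices\<close>

definition unity_root :: "nat \<Rightarrow> nat \<Rightarrow> complex" where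
  "unity_root n m = cis (2 * pi * real m / real n)"

lemma norm_unity_root [simp]: "cmod (unity_root n m) = 1"
  by (simp add: unity_root_def)

lemma unity_root_mult_cnj [simp]: "unity_root n m * cnj (unity_root n m) = 1"
  by (simp flip: complex_norm_square)

lemma unity_root_0 [simp]: "unity_root n 0 = 1"
  by (simp add: unity_root_def)

lemma unity_root_add: "unity_root n (a + b) = unity_root n a * unity_root n b"
  by (simp add: unity_root_def cis_mult add_divide_distrib distrib_left)

lemma unity_root_mult: "unity_root n (a * b) = unity_root n a ^ b"
  by (simp add: unity_root_def Complex.DeMoivre field_simps)

lemma unity_root_eq_1_iff:
  assumes "n > 0"
  shows "unity_root n m = 1 \<longleftrightarrow> n dvd m"
proof
  assume "n dvd m"
  then obtain c where "m = n * c" ..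
  then show "unity_root n m = 1"
    using assms cis_multiple_2pi[of "real c"] by (simp add: unity_root_def mult.assoc)
next
  assume "unity_root n m = 1"
  then obtain c where "2 * pi * real m / real n = of_int c * (2 * pi)"
    by (auto simp: unity_root_def cis_eq_1_iff)
  then have "real m = of_int c * real n"
    using assms by (simp add: field_simps)
  then have "int m = c * int n"
    by (metis of_int_eq_iff of_int_mult of_int_of_nat_eq)
  then show "n dvd m"
    by (metis dvd_triv_right of_nat_dvd_iff)
qed

lemma unity_root_mod:
  assumes "n > 0"
  shows "unity_root n (m mod n) = unity_root n m"
proof -
  have "unity_root n m = unity_root n (n * (m div n)) * unity_root n (m mod n)"
    by (simp flip: unity_root_add)
  also have "unity_root n (n * (m div n)) = 1"
    using assms by (simp add: unity_root_eq_1_iff)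
  finally show ?thesis by simp
qed

lemma sum_unity_root_eq_0:
  assumes "n > 0" "\<not> n dvd k"
  shows "(\<Sum>j<n. unity_root n (j * k)) = 0"
proof -
  have ne: "unity_root n k \<noteq> 1"
    using assms by (simp add: unity_root_eq_1_iff)
  have "(\<Sum>j<n. unity_root n (j * k)) = (\<Sum>j<n. unity_root n k ^ j)"
    by (simp add: unity_root_mult[symmetric] mult.commute)
  also have "\<dots> = (unity_root n k ^ n - 1) / (unity_root n k - 1)"
    using ne by (rule geometric_sum)
  also have "unity_root n k ^ n = 1"
    using assms by (simp add: unity_root_eq_1_iff flip: unity_root_mult)
  finally show ?thesis by simp
qed

lemma sum_periodic_shift:
  fixes g :: "nat \<Rightarrow> 'a :: ab_group_add"
  assumes "\<And>j. g (j + n) = g j"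
  shows "(\<Sum>j<n. g (j + m)) = (\<Sum>j<n. g j)"
proof (induction m)
  case (Suc m)
  have "(\<Sum>j<n. g (j + Suc m)) + g m = (\<Sum>j<Suc n. g (j + m))"
    by (simp only: sum.lessThan_Suc_shift) (simp add: add.commute)
  also have "\<dots> = (\<Sum>j<n. g (j + m)) + g m"
    using assms[of m] by (simp add: add.commute)
  finally show ?case using Suc by simp
qed simp

text \<open>Expanding the squared modulus and summing over \<open>k\<close> first leaves only the
  diagonal, by orthogonality of the characters.\<close>

lemma parseval:
  assumes "n > 0"
  shows "(\<Sum>k<n. (cmod (\<Sum>j<n. complex_of_real (x j) * unity_root n (j * k)))\<^sup>2)
       = real n * (\<Sum>j<n. (x j)\<^sup>2)"
proof -
  have orth: "(\<Sum>k<n. unity_root n (i * k) * cnj (unity_root n (j * k))) = (if i = j then of_nat n else 0)"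
    if "i < n" "j < n" for i j
  proof -
    \<comment> \<open>Indices are natural numbers, so the conjugate is represented by the
      nonnegative index \<open>n - j\<close>.\<close>
    have eq: "unity_root n (i * k) * cnj (unity_root n (j * k)) = unity_root n (k * (i + (n - j)))" for k
    proof -
      have "unity_root n (k * (n - j)) * unity_root n (j * k) = unity_root n (k * n)"
        using that by (metis add.commute distrib_left le_add_diff_inverse less_imp_le mult.commute unity_root_add)
      also have "\<dots> = 1" using assms by (simp add: unity_root_eq_1_iff)
      finally have "unity_root n (k * (n - j)) * unity_root n (j * k) = 1" .
      then have "unity_root n (k * (n - j)) * (unity_root n (j * k) * cnj (unity_root n (j * k)))
         = cnj (unity_root n (j * k))"
        by (metis mult.assoc mult_1)
      then have "unity_root n (k * (n - j)) = cnj (unity_root n (j * k))"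
        by simp
      then show ?thesis by (simp add: distrib_left unity_root_add mult.commute)
    qed
    show ?thesis
    proof (cases "i = j")
      case True
      then show ?thesis by simp
    next
      case False
      have "\<not> n dvd i + (n - j)"
      proof
        assume "n dvd i + (n - j)"
        then obtain c where c: "i + (n - j) = n * c" ..
        \<comment> \<open>The sum lies strictly between 0 and \<open>2 * n\<close>, so it can only
          be \<open>n\<close> itself, which forces \<open>i = j\<close>.\<close>
        then have "n * c < n * 2" "0 < n * c" using that by linarith+
        then have "c = 1" by auto
        then show False using that c False by simp
      qed
      then show ?thesis
        using False assms by (simp add: eq sum_unity_root_eq_0)
    qed
  qed
  let ?X = "\<lambda>k. \<Sum>j<n. complex_of_real (x j) * unity_root n (j * k)"
  have "complex_of_real (\<Sum>k<n. (cmod (?X k))\<^sup>2) = (\<Sum>k<n. ?X k * cnj (?X k))"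
    by (simp only: complex_norm_square[symmetric] of_real_sum of_real_power)
  also have "\<dots> = (\<Sum>k<n. \<Sum>i<n. \<Sum>j<n. of_real (x i * x j) * (unity_root n (i * k) * cnj (unity_root n (j * k))))"
    by (simp only: cnj_sum sum_product complex_cnj_mult complex_cnj_complex_of_real of_real_mult mult_ac)
  also have "\<dots> = (\<Sum>i<n. \<Sum>j<n. \<Sum>k<n. of_real (x i * x j) * (unity_root n (i * k) * cnj (unity_root n (j * k))))"
    by (subst sum.swap) (intro sum.cong refl sum.swap)
  also have "\<dots> = (\<Sum>i<n. \<Sum>j<n. of_real (x i * x j) * (if i = j then of_nat n else 0))"
    by (intro sum.cong refl) (simp add: orth flip: sum_distrib_left)
  also have "\<dots> = (\<Sum>i<n. of_real (x i * x i) * of_nat n)"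
    by (intro sum.cong refl) (simp add: if_distrib cong: if_cong)
  also have "\<dots> = complex_of_real (real n * (\<Sum>j<n. (x j)\<^sup>2))"
    by (simp add: power2_eq_square sum_distrib_left mult_ac)
  finally show ?thesis by (simp only: of_real_eq_iff)
qed

text \<open>The discrete Fourier transform of the first row. The vector with entries
  \<open>unity_root n (j * k)\<close> is an eigenvector of the circulant matrix for this
  value.\<close>

definition circ_eigenvalue :: "nat \<Rightarrow> (nat \<Rightarrow> real) \<Rightarrow> nat \<Rightarrow> complex" where
  "circ_eigenvalue n c k = (\<Sum>j<n. complex_of_real (c j) * unity_root n (j * k))"

text \<open>A circulant matrix acts by circular correlation, which the Fourier transform turns into
  multiplication. The conjugate arises because the entries depend on \<open>j - i\<close> rather
  than \<open>i - j\<close> and \<open>c\<close> is real.\<close>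

lemma dft_circulant_mult:
  assumes "n > 0"
  shows "(\<Sum>i<n. complex_of_real (\<Sum>j<n. circulant n c i j * x j) * unity_root n (i * k))
       = cnj (circ_eigenvalue n c k) * (\<Sum>j<n. complex_of_real (x j) * unity_root n (j * k))"
proof -
  \<comment> \<open>For fixed \<open>j\<close>, the reflection of \<open>i\<close> to
    \<open>j - i\<close> modulo \<open>n\<close> is its own inverse; adding \<open>n\<close> avoids
    truncated subtraction.\<close>
  have invol: "(j + n - (j + n - i) mod n) mod n = i" if "j < n" "i < n" for i j
  proof (cases "i \<le> j")
    case True
    then have "(j + n - i) mod n = j - i"
      using that by (metis Nat.diff_add_assoc2 less_imp_diff_less mod_add_self2 mod_less)
    then show ?thesis using that True by simp
  next
    case False
    then have "(j + n - i) mod n = j + n - i" using that by (intro mod_less) linarith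
    then show ?thesis using that by simp
  qed
  have inner: "(\<Sum>i<n. complex_of_real (circulant n c i j) * unity_root n (i * k))
      = cnj (circ_eigenvalue n c k) * unity_root n (j * k)" if j: "j < n" for j
  proof -
    have "(\<Sum>i<n. complex_of_real (circulant n c i j) * unity_root n (i * k))
        = (\<Sum>m<n. complex_of_real (c m) * unity_root n (((j + n - m) mod n) * k))"
      using invol[OF j] assms
      by (intro sum.reindex_bij_witness[of _ "\<lambda>m. (j + n - m) mod n" "\<lambda>i. (j + n - i) mod n"])
         (auto simp: circulant_def)
    also have "\<dots> = (\<Sum>m<n. complex_of_real (c m) * (cnj (unity_root n (m * k)) * unity_root n (j * k)))"
    proof (intro sum.cong refl, goal_cases)
      case (1 m)
      have "unity_root n (((j + n - m) mod n) * k) = unity_root n ((j + n - m) * k)"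
        using assms by (metis mod_mult_left_eq unity_root_mod)
      moreover have "unity_root n ((j + n - m) * k) * unity_root n (m * k) = unity_root n (j * k)"
      proof -
        have "(j + n - m) * k + m * k = j * k + n * k"
          using 1 by (simp flip: distrib_right)
        moreover have "unity_root n (n * k) = 1"
          using assms by (simp add: unity_root_eq_1_iff)
        ultimately show ?thesis by (simp flip: unity_root_add) (simp add: unity_root_add)
      qed
      then have "unity_root n ((j + n - m) * k) * (unity_root n (m * k) * cnj (unity_root n (m * k)))
         = unity_root n (j * k) * cnj (unity_root n (m * k))"
        by (metis mult.assoc)
      ultimately show ?case by (simp add: mult.commute)
    qed
    finally show ?thesis
      by (simp add: circ_eigenvalue_def sum_distrib_right sum_distrib_left mult_ac)
  qed
  have "(\<Sum>i<n. complex_of_real (\<Sum>j<n. circulant n c i j * x j) * unity_root n (i * k))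
      = (\<Sum>j<n. complex_of_real (x j) * (\<Sum>i<n. complex_of_real (circulant n c i j) * unity_root n (i * k)))"
    by (simp add: sum_distrib_left sum_distrib_right mult_ac) (rule sum.swap)
  also have "\<dots> = (\<Sum>j<n. complex_of_real (x j) * (cnj (circ_eigenvalue n c k) * unity_root n (j * k)))"
    by (intro sum.cong refl) (simp add: inner)
  finally show ?thesis by (simp add: sum_distrib_left mult_ac)
qed

text \<open>Parseval is applied to \<open>x\<close> and to its image: in Fourier coordinates the map
  is multiplication by numbers of modulus at least \<open>s\<close>.\<close>

lemma sigma_min_circulant_ge:
  assumes "n > 0" "0 \<le> s" and s: "\<And>k. k < n \<Longrightarrow> s \<le> cmod (circ_eigenvalue n c k)"
  shows "s \<le> sigma_min n (circulant n c)"
  unfolding sigma_min_def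
proof (rule cINF_greatest)
  \<comment> \<open>A lower bound for the infimum requires a nonempty unit sphere; the first unit
    vector is a witness.\<close>
  have "(\<lambda>j. if j = 0 then 1 else 0) \<in> {x :: nat \<Rightarrow> real. (\<Sum>j<n. (x j)^2) = 1 \<and> (\<forall>j\<ge>n. x j = 0)}"
  proof -
    have "(\<Sum>j<n. (if j = 0 then 1 else 0 :: real)\<^sup>2) = (\<Sum>j<n. if j = 0 then 1 else 0)"
      by (intro sum.cong) auto
    then show ?thesis using assms(1) by (auto simp: sum.delta)
  qed
  then show "{x :: nat \<Rightarrow> real. (\<Sum>j<n. (x j)^2) = 1 \<and> (\<forall>j\<ge>n. x j = 0)} \<noteq> {}"
    by (rule ex_in_conv[THEN iffD1, OF exI])
next
  fix x :: "nat \<Rightarrow> real"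
  assume "x \<in> {x. (\<Sum>j<n. (x j)^2) = 1 \<and> (\<forall>j\<ge>n. x j = 0)}"
  then have x: "(\<Sum>j<n. (x j)^2) = 1" by simp
  let ?X = "\<lambda>k. \<Sum>j<n. complex_of_real (x j) * unity_root n (j * k)"
  have "real n * s\<^sup>2 = (\<Sum>k<n. s\<^sup>2 * (cmod (?X k))\<^sup>2)"
    using parseval[OF assms(1), of x] x by (simp flip: sum_distrib_left)
  also have "\<dots> \<le> (\<Sum>k<n. (cmod (circ_eigenvalue n c k))\<^sup>2 * (cmod (?X k))\<^sup>2)"
    using s assms(2) by (intro sum_mono mult_right_mono power_mono) auto
  also have "\<dots> = real n * (\<Sum>i<n. (\<Sum>j<n. circulant n c i j * x j)\<^sup>2)"
    by (simp only: parseval[OF assms(1), symmetric] dft_circulant_mult[OF assms(1)]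
        norm_mult power_mult_distrib complex_mod_cnj)
  finally have "s\<^sup>2 \<le> (\<Sum>i<n. (\<Sum>j<n. circulant n c i j * x j)\<^sup>2)"
    using assms(1) by simp
  then show "s \<le> sqrt (\<Sum>i<n. (\<Sum>j<n. circulant n c i j * x j)\<^sup>2)"
    by (rule real_le_rsqrt)
qed

lemma sigma_min_circulant_le_imp:
  assumes "n > 0" "sigma_min n (circulant n c) \<le> t"
  shows "\<exists>k<n. cmod (circ_eigenvalue n c k) \<le> t"
proof (rule ccontr)
  assume "\<not> ?thesis"
  then have *: "t < cmod (circ_eigenvalue n c k)" if "k < n" for k
    using that by force
  \<comment> \<open>Passing to the minimum turns finitely many strict inequalities into one strict
    bound \<open>t < s\<close>.\<close>
  define s where "s = Min ((\<lambda>k. cmod (circ_eigenvalue n c k)) ` {..<n})"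
  have ne: "(\<lambda>k. cmod (circ_eigenvalue n c k)) ` {..<n} \<noteq> {}"
    using assms(1) by auto
  have "s \<in> (\<lambda>k. cmod (circ_eigenvalue n c k)) ` {..<n}"
    unfolding s_def by (rule Min_in) (use ne in auto)
  moreover have "s \<le> cmod (circ_eigenvalue n c k)" if "k < n" for k
    unfolding s_def by (rule Min_le) (use that in auto)
  ultimately have "t < s" "s \<le> sigma_min n (circulant n c)"
    using * by (auto intro!: sigma_min_circulant_ge assms(1))
  with assms(2) show False by simp
qed

section \<open>Phases of the roots of unity\<close>

text \<open>Taylor expansion to fourth order gives at least x^2/2 - x^4/24, and x^4 is at most x^2
  on [-1, 1].\<close>

lemma one_minus_cos_ge:
  fixes x :: real
  assumes "\<bar>x\<bar> \<le> 1"
  shows "x\<^sup>2 / 4 \<le> 1 - cos x"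
proof -
  obtain t where t: "cos x = (\<Sum>m<4. cos_coeff m * x ^ m) + cos (t + 1/2 * real 4 * pi) / fact 4 * x ^ 4"
    using Maclaurin_cos_expansion[of x 4] by blast
  have "cos (t + 1/2 * real 4 * pi) / fact 4 * x ^ 4 \<le> 1 / 24 * x ^ 4"
    by (intro mult_right_mono) (auto simp: fact_numeral)
  moreover have "(\<Sum>m<4. cos_coeff m * x ^ m) = 1 - x\<^sup>2 / 2"
    proof -
    have "(4::nat) = Suc (Suc (Suc (Suc 0)))" by simp
    then show ?thesis by (simp only: sum.lessThan_Suc) (simp add: cos_coeff_def fact_numeral power2_eq_square)
  qed
  moreover have "x ^ 4 \<le> x\<^sup>2"
  proof -
    have "x\<^sup>2 \<le> 1" using assms by (simp add: abs_square_le_1)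
    then have "x\<^sup>2 * x\<^sup>2 \<le> x\<^sup>2 * 1" by (intro mult_left_mono) auto
    then show ?thesis by (simp flip: power_add)
  qed
  ultimately show ?thesis using t zero_le_power2[of x] by linarith
qed

text \<open>Since 1 - cos x is twice the square of sin(x/2), this follows from |sin(a - b)| <= |sin
  a| + |sin b| and (p + q)^2 <= 2 p^2 + 2 q^2.\<close>

lemma one_minus_cos_diff_le:
  fixes a b :: real
  shows "1 - cos (a - b) \<le> 2 * (1 - cos a) + 2 * (1 - cos b)"
proof -
  have half: "1 - cos x = 2 * (sin (x/2))\<^sup>2" for x :: real
    using cos_double_sin[of "x/2"] by simp
  have "\<bar>sin (a/2 - b/2)\<bar> \<le> \<bar>sin (a/2)\<bar> * \<bar>cos (b/2)\<bar> + \<bar>cos (a/2)\<bar> * \<bar>sin (b/2)\<bar>"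
    by (simp add: sin_diff abs_mult[symmetric] abs_triangle_ineq4)
  also have "\<dots> \<le> \<bar>sin (a/2)\<bar> * 1 + 1 * \<bar>sin (b/2)\<bar>"
    by (intro add_mono mult_mono) auto
  finally have "(sin (a/2 - b/2))\<^sup>2 \<le> (\<bar>sin (a/2)\<bar> + \<bar>sin (b/2)\<bar>)\<^sup>2"
    by (simp add: abs_le_square_iff[symmetric])
  also have "\<dots> \<le> 2 * (sin (a/2))\<^sup>2 + 2 * (sin (b/2))\<^sup>2"
    using zero_le_power2[of "\<bar>sin (a/2)\<bar> - \<bar>sin (b/2)\<bar>"] by (simp add: power2_diff power2_sum)
  finally show ?thesis by (simp add: half diff_divide_distrib)
qed

text \<open>This is F of the overview; up to constants it is the sum of the squared distances of the
  phases to the multiples of 2 pi.\<close>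

definition phase_energy :: "nat \<Rightarrow> nat \<Rightarrow> complex \<Rightarrow> real" where
  "phase_energy n k \<theta> = (\<Sum>j<n. 1 - cos (Re (\<theta> * unity_root n (j * k))))"

text \<open>The phases lie in [-1, 1], so the quadratic cosine bound applies. In (Re w)^2 = (|w|^2 +
  Re(w^2)) / 2 the second terms sum to zero, being a full geometric sum with ratio
  \<open>unity_root n (2 * k)\<close>, which is not 1.\<close>

lemma phase_energy_small:
  assumes "n > 0" "\<not> n dvd 2 * k" "cmod \<theta> \<le> 1"
  shows "real n * (cmod \<theta>)\<^sup>2 / 8 \<le> phase_energy n k \<theta>"
proof -
  have sq: "(Re w)\<^sup>2 = ((cmod w)\<^sup>2 + Re (w\<^sup>2)) / 2" for w
    unfolding cmod_power2 by (simp add: power2_eq_square)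
  have "unity_root n (j * k) ^ 2 = unity_root n (j * (2 * k))" for j
    by (simp add: mult_ac flip: unity_root_mult)
  then have "(\<Sum>j<n. (\<theta> * unity_root n (j * k))\<^sup>2) = \<theta>\<^sup>2 * (\<Sum>j<n. unity_root n (j * (2 * k)))"
    by (simp add: power_mult_distrib sum_distrib_left)
  also have "\<dots> = 0" using sum_unity_root_eq_0[OF assms(1,2)] by simp
  finally have z: "(\<Sum>j<n. Re ((\<theta> * unity_root n (j * k))\<^sup>2)) = 0"
    by (metis Re_sum zero_complex.sel(1))
  have "real n * (cmod \<theta>)\<^sup>2 / 8 = (\<Sum>j<n. (Re (\<theta> * unity_root n (j * k)))\<^sup>2) / 4"
    unfolding sq using z by (simp add: norm_mult sum.distrib flip: sum_divide_distrib)
  also have "\<dots> = (\<Sum>j<n. (Re (\<theta> * unity_root n (j * k)))\<^sup>2 / 4)"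
    by (simp add: sum_divide_distrib)
  also have "\<dots> \<le> phase_energy n k \<theta>"
    unfolding phase_energy_def
  proof (intro sum_mono one_minus_cos_ge)
    fix j
    have "\<bar>Re (\<theta> * unity_root n (j * k))\<bar> \<le> cmod (\<theta> * unity_root n (j * k))"
      by (rule abs_Re_le_cmod)
    also have "\<dots> \<le> 1" using assms by (simp add: norm_mult)
    finally show "\<bar>Re (\<theta> * unity_root n (j * k))\<bar> \<le> 1" .
  qed
  finally show ?thesis .
qed

text \<open>Each new phase is the difference of the old phases with indices \<open>j + m\<close> and
  \<open>j\<close>. The difference inequality gives a factor 2 for each, and periodicity makes the
  two sums equal.\<close>

lemma phase_energy_shift:
  assumes "n > 0"
  shows "phase_energy n k (\<theta> * (unity_root n (m * k) - 1)) \<le> 4 * phase_energy n k \<theta>"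
proof -
  let ?g = "\<lambda>j. 1 - cos (Re (\<theta> * unity_root n (j * k)))"
  have "phase_energy n k (\<theta> * (unity_root n (m * k) - 1)) \<le> (\<Sum>j<n. 2 * ?g (j + m) + 2 * ?g j)"
    unfolding phase_energy_def
  proof (intro sum_mono)
    fix j
    have "Re (\<theta> * (unity_root n (m * k) - 1) * unity_root n (j * k))
        = Re (\<theta> * unity_root n ((j + m) * k)) - Re (\<theta> * unity_root n (j * k))"
      by (simp only: minus_complex.sel(1)[symmetric] distrib_right unity_root_add) (simp add: algebra_simps)
    then show "1 - cos (Re (\<theta> * (unity_root n (m * k) - 1) * unity_root n (j * k)))
        \<le> 2 * ?g (j + m) + 2 * ?g j"
      by (simp only: one_minus_cos_diff_le)
  qed
  also have "\<dots> = 2 * (\<Sum>j<n. ?g (j + m)) + 2 * (\<Sum>j<n. ?g j)"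
    by (simp only: sum.distrib sum_distrib_left)
  also have "(\<Sum>j<n. ?g (j + m)) = (\<Sum>j<n. ?g j)"
  proof (rule sum_periodic_shift)
    fix j
    have "unity_root n (n * k) = 1" using assms by (simp add: unity_root_eq_1_iff)
    then show "?g (j + n) = ?g j" by (simp add: distrib_right unity_root_add)
  qed
  finally show ?thesis by (simp add: phase_energy_def)
qed

text \<open>After cancelling the gcd, the order is coprime to \<open>k'\<close> and divides
  \<open>2 * k'\<close>, hence divides 2.\<close>

lemma not_dvd_double_if_order_ge_3:
  fixes n k :: nat
  assumes "n > 0" "3 \<le> n div gcd k n"
  shows "\<not> n dvd 2 * k"
proof
  assume dvd: "n dvd 2 * k"
  obtain k' d where kd: "k = k' * gcd k n" "n = d * gcd k n" "coprime k' d"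
    using gcd_coprime_exists[of k n] assms by auto
  have g: "gcd k n > 0" using assms by simp
  have d: "n div gcd k n = d" using kd(2) g by (metis nonzero_mult_div_cancel_right less_numeral_extra(3))
  have "d * gcd k n dvd (2 * k') * gcd k n" using dvd kd by (metis mult.assoc)
  then have "d dvd 2 * k'" using g by (metis dvd_times_right_cancel_iff less_not_refl)
  then have "d dvd 2" using kd(3) by (simp add: coprime_commute coprime_dvd_mult_left_iff)
  then show False using assms d by (auto dest: dvd_imp_le)
qed

text \<open>Multiplying \<open>\<theta>\<close> by a suitable
  \<open>unity_root n (s * k) - 1\<close> brings its modulus into [1/4, 1], where the quadratic
  bound applies. The constant is 512 = 4 * 8 * 16, from the shift, the quadratic bound and the
  square of 1/4.\<close>

lemma phase_energy_large:
  assumes n: "n > 0" and "1 \<le> cmod \<theta>" and d: "2 * pi * cmod \<theta> \<le> real (n div gcd k n)"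
  shows "real n / 512 \<le> phase_energy n k \<theta>"
proof -
  define g d' R where "g = gcd k n" and "d' = n div g" and "R = cmod \<theta>"
  have g: "g > 0" "n = d' * g" using n by (auto simp: g_def d'_def)
  have R: "R \<ge> 1" "2 * pi * R \<le> real d'" using assms by (auto simp: R_def d'_def g_def)
  \<comment> \<open>The real number \<open>y\<close> would make the rotation angle exactly
    \<open>1 / R\<close>; the assumption on the order gives \<open>y \<ge> 1\<close>.\<close>
  define y where "y = real d' / (2 * pi * R)"
  have d'0: "d' > 0" using g n by (cases d') auto
  have y: "y \<ge> 1" using R by (simp add: y_def field_simps)
  \<comment> \<open>As \<open>y \<ge> 1\<close>, rounding down loses at most a factor 2, so
    \<open>h * R\<close> ends up in [1/2, 1].\<close>
  define m where "m = nat \<lfloor>y\<rfloor>"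
  have m: "real m \<le> y" "y / 2 \<le> real m"
  proof -
    have "real m = of_int \<lfloor>y\<rfloor>" "1 \<le> \<lfloor>y\<rfloor>" using y by (auto simp: m_def)
    then show "real m \<le> y" "y / 2 \<le> real m" using floor_correct[of y] by linarith+
  qed
  define h where "h = 2 * pi * real m / real d'"
  have "h = real m / (y * R)" using R d'0 by (simp add: h_def y_def field_simps)
  then have h: "h * R = real m / y" using R y by (simp add: field_simps)
  have hR: "h * R \<le> 1" "1/2 \<le> h * R" using m y unfolding h by (auto simp: field_simps)
  have h0: "0 \<le> h" by (simp add: h_def)
  have h1: "h \<le> 1" using hR R h0 mult_left_mono[of 1 R h] by simp
  \<comment> \<open>By Bezout, multiples of \<open>k\<close> reach every multiple of the gcd modulo
    \<open>n\<close>, so rotation by any multiple of \<open>2 * pi / d'\<close> is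
    available.\<close>
  obtain a where a: "[k * a = g] (mod n)"
    using cong_solve_nat[of k n] unfolding g_def by auto
  define s where "s = a * m"
  have "[s * k = m * g] (mod n)"
    using cong_scalar_right[OF a, of m] by (simp add: s_def mult_ac)
  then have "unity_root n (s * k) = unity_root n (m * g)"
    by (metis unity_root_mod[OF n] cong_def)
  also have "\<dots> = cis h" using g by (simp add: unity_root_def h_def mult.assoc)
  finally have w: "unity_root n (s * k) = cis h" .
  \<comment> \<open>The chord length 2 sin(h/2) is compared with the angle: it lies between
    \<open>h / 2\<close> and \<open>h\<close>.\<close>
  have sq: "(cmod (cis h - 1))\<^sup>2 = 2 * (1 - cos h)"
    using sin_cos_squared_add[of h] unfolding cmod_power2 by (simp add: power2_eq_square algebra_simps)
  have "h\<^sup>2 / 4 \<le> 1 - cos h" using h0 h1 by (intro one_minus_cos_ge) auto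
  then have "(h/2)\<^sup>2 \<le> (cmod (cis h - 1))\<^sup>2" 
  proof -
    have "(h/2)\<^sup>2 \<le> 1 - cos h" using \<open>h\<^sup>2 / 4 \<le> 1 - cos h\<close> by (simp add: power_divide)
    also have "\<dots> \<le> 2 * (1 - cos h)" by simp
    finally show ?thesis by (simp only: sq)
  qed
  then have lo: "h / 2 \<le> cmod (cis h - 1)" by (rule power2_le_imp_le) simp
  have "1 - cos h \<le> h\<^sup>2 / 2" 
  proof -
    have "(sin (h/2))\<^sup>2 \<le> (h/2)\<^sup>2"
      using abs_sin_x_le_abs_x[of "h/2"] by (simp only: abs_le_square_iff)
    then show ?thesis using cos_double_sin[of "h/2"] by (simp add: power_divide)
  qed
  then have "(cmod (cis h - 1))\<^sup>2 \<le> h\<^sup>2" using sq by simp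
  then have hi: "cmod (cis h - 1) \<le> h" using h0 by (rule power2_le_imp_le)
  define \<theta>' where "\<theta>' = \<theta> * (unity_root n (s * k) - 1)"
  have n': "cmod \<theta>' = R * cmod (cis h - 1)" by (simp add: \<theta>'_def w R_def norm_mult)
  have "R * cmod (cis h - 1) \<le> R * h" "R * (h/2) \<le> R * cmod (cis h - 1)"
    using lo hi R by (auto intro!: mult_left_mono simp del: times_divide_eq_right)
  then have bnd: "cmod \<theta>' \<le> 1" "1/4 \<le> cmod \<theta>'" using hR by (auto simp: n' mult.commute)
  have "real d' \<ge> 3" using R pi_gt3 mult_mono[of 3 "2*pi" 1 R] by simp
  then have "\<not> n dvd 2 * k"
    by (intro not_dvd_double_if_order_ge_3 n) (simp add: d'_def g_def)
  then have "real n * (cmod \<theta>')\<^sup>2 / 8 \<le> 4 * phase_energy n k \<theta>"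
    using phase_energy_small[OF n _ bnd(1)] phase_energy_shift[OF n, of k \<theta> s] 
    unfolding \<theta>'_def by force
  moreover have "real n * (1/4)\<^sup>2 \<le> real n * (cmod \<theta>')\<^sup>2"
    using bnd by (intro mult_left_mono power_mono) auto
  ultimately show ?thesis by (simp add: power2_eq_square)
qed

lemma phase_energy_ge:
  assumes n: "n > 0" and "\<not> n dvd 2 * k" "2 * pi * cmod \<theta> \<le> real (n div gcd k n)"
  shows "real n / 512 * min 1 ((cmod \<theta>)\<^sup>2) \<le> phase_energy n k \<theta>"
proof (cases "cmod \<theta> \<le> 1")
  case True
  have "real n / 512 * min 1 ((cmod \<theta>)\<^sup>2) \<le> real n / 8 * (cmod \<theta>)\<^sup>2"
    by (intro mult_mono) auto
  then show ?thesis using phase_energy_small[OF assms(1,2) True] by simp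
next
  case False
  have "real n / 512 * min 1 ((cmod \<theta>)\<^sup>2) \<le> real n / 512 * 1"
    by (intro mult_mono) auto
  then show ?thesis using phase_energy_large[OF n _ assms(3)] False by simp
qed

section \<open>Counting the exceptional indices\<close>

text \<open>The index \<open>k\<close> is determined by the fraction k/n in lowest terms, whose
  denominator is at most \<open>D\<close> and whose numerator is smaller still.\<close>

lemma card_small_order_le:
  fixes n D :: nat
  assumes "n > 0"
  shows "card {k. k < n \<and> n div gcd k n \<le> D} \<le> D\<^sup>2"
proof -
  let ?f = "\<lambda>k. (k div gcd k n, n div gcd k n)"
  have "inj_on ?f {k. k < n \<and> n div gcd k n \<le> D}"
  proof (rule inj_onI)
    fix k l assume "?f k = ?f l"
    then have eq: "k div gcd k n = l div gcd l n" "n div gcd k n = n div gcd l n" by auto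
    have "gcd k n = gcd l n"
      using eq(2) assms by (metis dvd_div_mult_self gcd_dvd2 mult_cancel1 not_gr_zero mult_0)
    then show "k = l" using eq(1) by (metis dvd_div_mult_self gcd_dvd1)
  qed
  moreover have "?f ` {k. k < n \<and> n div gcd k n \<le> D} \<subseteq> {..<D} \<times> {1..D}"
  proof -
    have "k div gcd k n < n div gcd k n" if "k < n" for k
      using that by (metis assms dvd_div_mult_self gcd_dvd1 gcd_dvd2 mult_less_cancel2)
    then show ?thesis by force
  qed
  ultimately have "card {k. k < n \<and> n div gcd k n \<le> D} \<le> card ({..<D} \<times> {1..D})"
    by (metis (no_types, lifting) card_inj_on_le finite_SigmaI finite_atLeastAtMost finite_lessThan)
  then show ?thesis by (simp add: power2_eq_square)
qed

lemma card_dvd_double_le: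
  fixes n :: nat
  assumes "n > 0"
  shows "card {k. k < n \<and> n dvd 2 * k} \<le> 2"
proof -
  have "{k. k < n \<and> n dvd 2 * k} \<subseteq> {0, n div 2}"
  proof
    fix k assume "k \<in> {k. k < n \<and> n dvd 2 * k}"
    then obtain c where c: "k < n" "2 * k = n * c" by auto
    then have "n * c < n * 2" by linarith
    then have "c < 2" by (simp only: mult_less_cancel1)
    then have "c = 0 \<or> c = 1" by auto
    with c show "k \<in> {0, n div 2}" by auto
  qed
  then have "card {k. k < n \<and> n dvd 2 * k} \<le> card {0, n div 2}"
    by (intro card_mono) auto
  also have "\<dots> \<le> 2" by (simp add: card_insert_if)
  finally show ?thesis .
qed

section \<open>Small-ball estimates by smoothing\<close>

text \<open>The triangular density on [-1, 1]: its bounded support restricts attention to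
  frequencies of size at most 1, and its Fourier transform is the nonnegative Fejer kernel.\<close>

definition tri :: "real measure" where
  "tri = density lborel (\<lambda>u. ennreal (max 0 (1 - \<bar>u\<bar>)))"

lemma sets_tri [simp, measurable_cong]: "sets tri = sets borel"
  and space_tri [simp]: "space tri = UNIV"
  by (simp_all add: tri_def)

lemma has_bochner_integral_tri_cos:
  fixes x :: real
  shows "has_bochner_integral lborel (\<lambda>u. max 0 (1 - \<bar>u\<bar>) * cos (u * x))
     (if x = 0 then 1 else 2 * (1 - cos x) / x\<^sup>2)"
proof -
  \<comment> \<open>An antiderivative on [0, 1], found by integration by parts; evenness doubles the
    result. The case \<open>x = 0\<close> is separate because of the divisions by
    \<open>x\<close>.\<close>
  define F where "F = (\<lambda>u. if x = 0 then u - u\<^sup>2 / 2 else (1 - u) * sin (u * x) / x - cos (u * x) / x\<^sup>2)"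
  have "has_bochner_integral lborel (\<lambda>u. indicator {0..1} u *\<^sub>R ((1 - u) * cos (u * x))) (F 1 - F 0)"
  proof (rule has_bochner_integral_FTC_Icc[where F = F and a = 0 and b = 1 and f = "\<lambda>u. (1 - u) * cos (u * x)"])
    fix u :: real
    have "DERIV F u :> (1 - u) * cos (u * x)"
    proof (cases "x = 0")
      case True
      then show ?thesis unfolding F_def by (auto intro!: derivative_eq_intros)
    next
      case False
      have F: "F = (\<lambda>u. (1 - u) * sin (u * x) / x - cos (u * x) / x\<^sup>2)"
        using False by (simp add: F_def)
      show ?thesis unfolding F using False
        by (auto intro!: derivative_eq_intros simp: field_simps power2_eq_square)
    qed
    then show "(F has_vector_derivative (1 - u) * cos (u * x)) (at u within {0..1})"
      by (simp add: has_real_derivative_iff_has_vector_derivative has_vector_derivative_at_within)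
    show "continuous_on {0..1} (\<lambda>u. (1 - u) * cos (u * x))" by (intro continuous_intros)
  qed simp
  also have "(\<lambda>u. indicator {0..1} u *\<^sub>R ((1 - u) * cos (u * x)))
     = (\<lambda>u. indicator {0..} u *\<^sub>R (max 0 (1 - \<bar>u\<bar>) * cos (u * x)))"
    by (auto simp: fun_eq_iff indicator_def max_def)
  finally have "has_bochner_integral lborel (\<lambda>u. max 0 (1 - \<bar>u\<bar>) * cos (u * x)) (2 *\<^sub>R (F 1 - F 0))"
    by (rule has_bochner_integral_even_function) simp
  moreover have "2 *\<^sub>R (F 1 - F 0) = (if x = 0 then 1 else 2 * (1 - cos x) / x\<^sup>2)"
    by (simp add: F_def field_simps)
  ultimately show ?thesis by simp
qed

lemma integral_tri:
  fixes f :: "real \<Rightarrow> real"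
  assumes "f \<in> borel_measurable borel"
  shows "integral\<^sup>L tri f = (\<integral>u. max 0 (1 - \<bar>u\<bar>) * f u \<partial>lborel)"
  unfolding tri_def using assms by (subst integral_density) auto

lemma integral_tri_cos:
  "(\<integral>u. cos (u * x) \<partial>tri) = (if x = 0 then 1 else 2 * (1 - cos x) / x\<^sup>2)"
  using has_bochner_integral_tri_cos[of x] integral_tri[of "\<lambda>u. cos (u * x)"]
  by (simp add: has_bochner_integral_iff)

lemma prob_space_tri: "prob_space tri"
proof
  have i: "has_bochner_integral lborel (\<lambda>u. max 0 (1 - \<bar>u\<bar>)) (1::real)"
    using has_bochner_integral_tri_cos[of 0] by simp
  have "emeasure tri (space tri) = (\<integral>\<^sup>+ u. ennreal (max 0 (1 - \<bar>u\<bar>)) \<partial>lborel)"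
    by (simp add: tri_def emeasure_density)
  also have "\<dots> = ennreal 1"
    using i by (subst nn_integral_eq_integral) (auto simp: has_bochner_integral_iff)
  finally show "emeasure tri (space tri) = 1" by simp
qed

interpretation tri: prob_space tri by (rule prob_space_tri)

lemma AE_tri_abs_le_1: "AE u in tri. \<bar>u\<bar> \<le> 1"
  unfolding tri_def by (subst AE_density) (auto simp: max_def)

text \<open>Together with the lower bound 1/2 on [-1, 1], this makes twice the kernel a majorant of
  the indicator of [-1, 1].\<close>

lemma integral_tri_cos_nonneg: "0 \<le> (\<integral>u. cos (u * x) \<partial>tri)"
  by (simp add: integral_tri_cos)

lemma integral_tri_cos_ge: "\<bar>x\<bar> \<le> 1 \<Longrightarrow> 1/2 \<le> (\<integral>u. cos (u * x) \<partial>tri)"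
  using one_minus_cos_ge[of x] by (simp add: integral_tri_cos field_simps)

text \<open>The triangular weight is at most 1, so the full Gaussian integral is an upper
  bound.\<close>

lemma integral_tri_exp_le:
  assumes "a > 0"
  shows "(\<integral>u. exp (- a * u\<^sup>2) \<partial>tri) \<le> sqrt (pi / a)"
proof -
  define \<sigma> where "\<sigma> = 1 / sqrt (2 * a)"
  have \<sigma>: "\<sigma> > 0" "\<sigma>\<^sup>2 = 1 / (2 * a)" using assms by (auto simp: \<sigma>_def power_divide)
  have e: "exp (- a * u\<^sup>2) = sqrt (pi / a) * normal_density 0 \<sigma> u" for u
    using assms by (simp add: normal_density_def \<sigma> real_sqrt_divide field_simps)
  have int: "integrable lborel (\<lambda>u. exp (- a * u\<^sup>2))"
    unfolding e using \<sigma>(1) by (intro integrable_mult_right integrable_normal_density)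
  have "(\<integral>u. exp (- a * u\<^sup>2) \<partial>tri) = (\<integral>u. max 0 (1 - \<bar>u\<bar>) * exp (- a * u\<^sup>2) \<partial>lborel)"
    by (rule integral_tri) simp
  also have "\<dots> \<le> (\<integral>u. exp (- a * u\<^sup>2) \<partial>lborel)"
    using int by (intro integral_mono' ) (auto intro: mult_left_le_one_le)
  also have "\<dots> = sqrt (pi / a)"
    unfolding e using \<sigma>(1) by simp
  finally show ?thesis .
qed

lemma (in pair_prob_space)
  fixes f :: "'a \<Rightarrow> 'b \<Rightarrow> real"
  assumes [measurable]: "case_prod f \<in> borel_measurable (M1 \<Otimes>\<^sub>M M2)"
    and "\<And>x y. \<bar>f x y\<bar> \<le> B"
  shows integrable_fst_bounded: "integrable M1 (\<lambda>x. \<integral>y. f x y \<partial>M2)"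
    and integrable_snd_bounded: "integrable M2 (\<lambda>y. \<integral>x. f x y \<partial>M1)"
    and Fubini_bounded: "(\<integral>x. (\<integral>y. f x y \<partial>M2) \<partial>M1) = (\<integral>y. (\<integral>x. f x y \<partial>M1) \<partial>M2)"
proof -
  have "integrable (M1 \<Otimes>\<^sub>M M2) (case_prod f)"
    using assms by (intro P.integrable_const_bound[where B = B]) auto
  then show "integrable M1 (\<lambda>x. \<integral>y. f x y \<partial>M2)" "integrable M2 (\<lambda>y. \<integral>x. f x y \<partial>M1)"
    "(\<integral>x. (\<integral>y. f x y \<partial>M2) \<partial>M1) = (\<integral>y. (\<integral>x. f x y \<partial>M1) \<partial>M2)"
    by (auto intro: integrable_fst integrable_snd Fubini_integral[symmetric])
qed

lemma (in prob_space) abs_integral_bounded: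
  fixes f :: "'a \<Rightarrow> real"
  assumes "\<And>x. \<bar>f x\<bar> \<le> B"
  shows "\<bar>expectation f\<bar> \<le> B"
proof (cases "integrable M f")
  case True
  have "\<bar>expectation f\<bar> \<le> expectation (\<lambda>x. \<bar>f x\<bar>)" using integral_norm_bound[of M f] by simp
  also have "\<dots> \<le> expectation (\<lambda>_. B)" using True assms by (intro integral_mono) auto
  finally show ?thesis by (simp add: prob_space)
next
  case False
  \<comment> \<open>A non-integrable function has integral 0 by convention, and the bound at any one
    point shows that \<open>B\<close> is nonnegative.\<close>
  then show ?thesis using assms[of undefined] by (simp add: not_integrable_integral_eq)
qed

context prob_space
begin

text \<open>Esseen smoothing: the indicator is dominated by twice the kernel at \<open>X\<close>,
  whose expectation is, by Fubini, an average of characteristic function values over |u| <=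
  1.\<close>

lemma small_ball_1d:
  assumes [measurable]: "X \<in> borel_measurable M" and "a > 0"
    and cf: "\<And>u. \<bar>u\<bar> \<le> 1 \<Longrightarrow> expectation (\<lambda>\<omega>. cos (u * X \<omega>)) \<le> exp (- a * u\<^sup>2)"
  shows "prob {\<omega> \<in> space M. \<bar>X \<omega>\<bar> \<le> 1} \<le> 2 * sqrt (pi / a)"
proof -
  interpret P: pair_prob_space M tri ..
  have meas: "(\<lambda>(\<omega>, u). cos (u * X \<omega>)) \<in> borel_measurable (M \<Otimes>\<^sub>M tri)" by measurable
  have "prob {\<omega> \<in> space M. \<bar>X \<omega>\<bar> \<le> 1} = expectation (indicator {\<omega> \<in> space M. \<bar>X \<omega>\<bar> \<le> 1})"
    by simp
  also have "\<dots> \<le> expectation (\<lambda>\<omega>. 2 * (\<integral>u. cos (u * X \<omega>) \<partial>tri))"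
  proof (rule integral_mono)
    show "integrable M (\<lambda>\<omega>. 2 * (\<integral>u. cos (u * X \<omega>) \<partial>tri))"
      by (intro integrable_mult_right P.integrable_fst_bounded[OF meas, of 1]) simp
    fix \<omega>
    show "indicator {\<omega> \<in> space M. \<bar>X \<omega>\<bar> \<le> 1} \<omega> \<le> 2 * (\<integral>u. cos (u * X \<omega>) \<partial>tri)"
      using integral_tri_cos_ge[of "X \<omega>"] integral_tri_cos_nonneg[of "X \<omega>"]
      by (auto simp: indicator_def)
  qed (auto intro!: integrable_const_bound[where B = 1])
  also have "\<dots> = 2 * (\<integral>u. expectation (\<lambda>\<omega>. cos (u * X \<omega>)) \<partial>tri)"
    using P.Fubini_bounded[OF meas, of 1] by simp
  also have "(\<integral>u. expectation (\<lambda>\<omega>. cos (u * X \<omega>)) \<partial>tri) \<le> (\<integral>u. exp (- a * u\<^sup>2) \<partial>tri)"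
  proof (rule integral_mono_AE)
    show "integrable tri (\<lambda>u. expectation (\<lambda>\<omega>. cos (u * X \<omega>)))"
      by (rule P.integrable_snd_bounded[OF meas, of 1]) simp
    show "integrable tri (\<lambda>u. exp (- a * u\<^sup>2))"
      using \<open>a > 0\<close> by (intro tri.integrable_const_bound[where B = 1] AE_I2) auto
    show "AE u in tri. expectation (\<lambda>\<omega>. cos (u * X \<omega>)) \<le> exp (- a * u\<^sup>2)"
      using AE_tri_abs_le_1 by eventually_elim (rule cf)
  qed
  also have "\<dots> \<le> sqrt (pi / a)" using \<open>a > 0\<close> by (rule integral_tri_exp_le)
  finally show ?thesis by simp
qed

text \<open>The same smoothing with a product of two kernels, hence the factor 4. The term
  \<open>b\<close> allows for a characteristic function that stops decaying at a tiny level.\<close>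

lemma small_ball_2d:
  assumes [measurable]: "X \<in> borel_measurable M" "Y \<in> borel_measurable M" and "a > 0"
    and cf: "\<And>u v. \<bar>u\<bar> \<le> 1 \<Longrightarrow> \<bar>v\<bar> \<le> 1 \<Longrightarrow>
      expectation (\<lambda>\<omega>. cos (u * X \<omega> + v * Y \<omega>)) \<le> exp (- a * (u\<^sup>2 + v\<^sup>2)) + b"
  shows "prob {\<omega> \<in> space M. \<bar>X \<omega>\<bar> \<le> 1 \<and> \<bar>Y \<omega>\<bar> \<le> 1} \<le> 4 * (pi / a + b)"
proof -
  interpret P: pair_prob_space M tri ..
  let ?f = "\<lambda>x. \<integral>u. cos (u * x) \<partial>tri"
  let ?E = "\<lambda>u v. expectation (\<lambda>\<omega>. cos (u * X \<omega>) * cos (v * Y \<omega>))"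
  let ?I = "\<integral>u. exp (- a * u\<^sup>2) \<partial>tri"
  have [measurable]: "?f \<in> borel_measurable borel" by measurable
  have f1: "\<bar>?f x\<bar> \<le> 1" for x by (rule tri.abs_integral_bounded) simp
  have m1: "(\<lambda>(\<omega>, u). cos (u * X \<omega>) * ?f (Y \<omega>)) \<in> borel_measurable (M \<Otimes>\<^sub>M tri)" by measurable
  have b1: "\<bar>cos (u * X \<omega>) * ?f (Y \<omega>)\<bar> \<le> 1" for u \<omega>
    using f1 by (simp add: abs_mult mult_le_one)
  have m2: "(\<lambda>(\<omega>, v). cos (u * X \<omega>) * cos (v * Y \<omega>)) \<in> borel_measurable (M \<Otimes>\<^sub>M tri)" for u by measurable
  have b2: "\<bar>cos (u * X \<omega>) * cos (v * Y \<omega>)\<bar> \<le> 1" for u v \<omega>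
    by (simp add: abs_mult mult_le_one)
  have inner: "expectation (\<lambda>\<omega>. cos (u * X \<omega>) * ?f (Y \<omega>)) = (\<integral>v. ?E u v \<partial>tri)" for u
    using P.Fubini_bounded[OF m2 b2] by simp
  have bound: "?E u v \<le> exp (- a * u\<^sup>2) * exp (- a * v\<^sup>2) + b" if "\<bar>u\<bar> \<le> 1" "\<bar>v\<bar> \<le> 1" for u v
  proof -
    \<comment> \<open>The product kernel only sees the average over the frequencies (u, v) and (u,
      -v), both covered by the hypothesis.\<close>
    have "cos (u * X \<omega>) * cos (v * Y \<omega>) = (cos (u * X \<omega> + v * Y \<omega>) + cos (u * X \<omega> + (- v) * Y \<omega>)) / 2" for \<omega>
      by (simp add: cos_add cos_diff)
    then have "?E u v = expectation (\<lambda>\<omega>. (cos (u * X \<omega> + v * Y \<omega>) + cos (u * X \<omega> + (- v) * Y \<omega>)) / 2)"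
      by (simp only:)
    also have "\<dots> = (expectation (\<lambda>\<omega>. cos (u * X \<omega> + v * Y \<omega>)) + expectation (\<lambda>\<omega>. cos (u * X \<omega> + (- v) * Y \<omega>))) / 2"
      by (subst integral_divide_zero, subst Bochner_Integration.integral_add)
         (auto intro!: integrable_const_bound[where B = 1])
    also have "\<dots> \<le> exp (- a * (u\<^sup>2 + v\<^sup>2)) + b"
      using cf[of u v] cf[of u "- v"] that by simp
    finally show ?thesis by (simp add: distrib_left exp_add[symmetric])
  qed
  have ie: "integrable tri (\<lambda>u. exp (- a * u\<^sup>2))"
    using \<open>a > 0\<close> by (intro tri.integrable_const_bound[where B = 1] AE_I2) auto
  have "prob {\<omega> \<in> space M. \<bar>X \<omega>\<bar> \<le> 1 \<and> \<bar>Y \<omega>\<bar> \<le> 1}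
      = expectation (indicator {\<omega> \<in> space M. \<bar>X \<omega>\<bar> \<le> 1 \<and> \<bar>Y \<omega>\<bar> \<le> 1})"
    by simp
  also have "\<dots> \<le> expectation (\<lambda>\<omega>. 4 * (?f (X \<omega>) * ?f (Y \<omega>)))"
  proof (rule integral_mono)
    show "integrable M (\<lambda>\<omega>. 4 * (?f (X \<omega>) * ?f (Y \<omega>)))"
      using f1 by (intro integrable_mult_right integrable_const_bound[where B = 1] AE_I2)
        (auto simp: abs_mult intro!: mult_le_one)
    fix \<omega>
    have "1/2 * (1/2) \<le> ?f (X \<omega>) * ?f (Y \<omega>)" if "\<bar>X \<omega>\<bar> \<le> 1" "\<bar>Y \<omega>\<bar> \<le> 1"
      using that by (intro mult_mono integral_tri_cos_ge integral_tri_cos_nonneg) auto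
    then show "indicator {\<omega> \<in> space M. \<bar>X \<omega>\<bar> \<le> 1 \<and> \<bar>Y \<omega>\<bar> \<le> 1} \<omega> \<le> 4 * (?f (X \<omega>) * ?f (Y \<omega>))"
      by (auto simp: indicator_def integral_tri_cos_nonneg)
  qed (auto intro!: integrable_const_bound[where B = 1])
  also have "\<dots> = 4 * (\<integral>u. (\<integral>v. ?E u v \<partial>tri) \<partial>tri)"
    using P.Fubini_bounded[OF m1 b1] by (simp flip: inner)
  also have "(\<integral>u. (\<integral>v. ?E u v \<partial>tri) \<partial>tri) \<le> (\<integral>u. exp (- a * u\<^sup>2) * ?I + b \<partial>tri)"
  proof (rule integral_mono_AE)
    show "integrable tri (\<lambda>u. \<integral>v. ?E u v \<partial>tri)"
      using P.integrable_snd_bounded[OF m1 b1] by (simp add: inner)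
    show "integrable tri (\<lambda>u. exp (- a * u\<^sup>2) * ?I + b)" using ie by simp
    show "AE u in tri. (\<integral>v. ?E u v \<partial>tri) \<le> exp (- a * u\<^sup>2) * ?I + b"
      using AE_tri_abs_le_1
    proof eventually_elim
      case (elim u)
      have "(\<integral>v. ?E u v \<partial>tri) \<le> (\<integral>v. exp (- a * u\<^sup>2) * exp (- a * v\<^sup>2) + b \<partial>tri)"
      proof (rule integral_mono_AE)
        show "integrable tri (?E u)" by (rule P.integrable_snd_bounded[OF m2 b2])
        show "integrable tri (\<lambda>v. exp (- a * u\<^sup>2) * exp (- a * v\<^sup>2) + b)" using ie by simp
        show "AE v in tri. ?E u v \<le> exp (- a * u\<^sup>2) * exp (- a * v\<^sup>2) + b"
          using AE_tri_abs_le_1 by eventually_elim (rule bound[OF elim])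
      qed
      also have "\<dots> = exp (- a * u\<^sup>2) * ?I + b"
        using ie by (subst Bochner_Integration.integral_add) (auto simp: tri.prob_space[simplified])
      finally show ?case .
    qed
  qed
  also have "\<dots> = ?I * ?I + b"
    using ie by (subst Bochner_Integration.integral_add) (auto simp: tri.prob_space[simplified])
  also have "\<dots> \<le> sqrt (pi / a) * sqrt (pi / a) + b"
    using integral_tri_exp_le[OF \<open>a > 0\<close>] \<open>a > 0\<close> by (intro add_mono mult_mono) auto
  also have "\<dots> = pi / a + b" using \<open>a > 0\<close> by simp
  finally show ?thesis by simp
qed

end

section \<open>Sums of independent variables\<close>

text \<open>Symmetrisation: the right side is the characteristic function of the difference of two
  independent copies.\<close>

lemma (in real_distribution) cmod_char_square:
  "(cmod (char M s))\<^sup>2 = (\<integral>x. \<integral>y. cos (s * (x - y)) \<partial>M \<partial>M)"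
proof -
  have i: "integrable M (\<lambda>x. cos (s * x))" "integrable M (\<lambda>x. sin (s * x))"
    by (auto intro!: integrable_const_bound[where B = 1])
  have ie: "integrable M (\<lambda>x. iexp (s * x))" by (rule integrable_iexp) auto
  have Re: "Re (char M s) = (\<integral>x. cos (s * x) \<partial>M)" and Im: "Im (char M s) = (\<integral>x. sin (s * x) \<partial>M)"
    unfolding char_def using integral_Re[OF ie] integral_Im[OF ie] by (simp_all add: Re_exp Im_exp)
  have "(\<integral>x. \<integral>y. cos (s * (x - y)) \<partial>M \<partial>M)
      = (\<integral>x. cos (s * x) * Re (char M s) + sin (s * x) * Im (char M s) \<partial>M)"
    using i by (simp add: right_diff_distrib cos_diff Re Im)
  also have "\<dots> = (Re (char M s))\<^sup>2 + (Im (char M s))\<^sup>2"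
    using i by (simp add: Re[symmetric] Im[symmetric] power2_eq_square)
  finally show ?thesis by (simp add: cmod_power2)
qed

text \<open>For independent copies x and y, the event |x| <= K, |y| <= K, |x - y| > 1 has
  probability at least (1 - q/2) q/2 >= q/4, and there the energy at x - y is at least
  \<open>b\<close>. Averaging bounds the sum of 1 - |char|^2 from below.\<close>

lemma (in real_distribution) prod_char_le:
  fixes s :: "'i \<Rightarrow> real"
  assumes "finite J" "0 \<le> b" "0 < q" "q < 1"
    and conc: "\<And>u. measure M {x. \<bar>x - u\<bar> \<le> 1} \<le> 1 - q"
    and tail: "measure M {x. \<bar>x\<bar> > K} \<le> q / 2"
    and energy: "\<And>\<eta>. 1 \<le> \<bar>\<eta>\<bar> \<Longrightarrow> \<bar>\<eta>\<bar> \<le> 2 * K \<Longrightarrow> b \<le> (\<Sum>j\<in>J. 1 - cos (s j * \<eta>))"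
  shows "(\<Prod>j\<in>J. cmod (char M (s j))) \<le> exp (- (q / 8) * b)"
proof -
  let ?f = "\<lambda>x y. \<Sum>j\<in>J. 1 - cos (s j * (x - y))"
  interpret P: pair_prob_space M M ..
  have f0: "0 \<le> ?f x y" for x y by (intro sum_nonneg) simp
  have fB: "\<bar>?f x y\<bar> \<le> 2 * real (card J)" for x y
  proof -
    have "\<bar>?f x y\<bar> \<le> (\<Sum>j\<in>J. \<bar>1 - cos (s j * (x - y))\<bar>)" by (rule sum_abs)
    also have "\<dots> \<le> (\<Sum>j\<in>J. 2)"
    proof (intro sum_mono)
      fix j show "\<bar>1 - cos (s j * (x - y))\<bar> \<le> 2" using cos_ge_minus_one[of "s j * (x - y)"] by simp
    qed
    finally show ?thesis by simp
  qed
  have fm: "(\<lambda>(x, y). ?f x y) \<in> borel_measurable (M \<Otimes>\<^sub>M M)" by measurable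
  have inner: "q / 2 * b \<le> (\<integral>y. ?f x y \<partial>M)" if x: "\<bar>x\<bar> \<le> K" for x
  proof -
    define A where "A = {y. 1 < \<bar>y - x\<bar> \<and> \<bar>y\<bar> \<le> K}"
    have [simp, measurable]: "A \<in> sets borel" by (simp add: A_def)
    \<comment> \<open>Union bound: the first two sets have mass at most 1 - q and q/2, which leaves
      at least q/2 for \<open>A\<close>.\<close>
    have "1 \<le> prob ({y. \<bar>y - x\<bar> \<le> 1} \<union> ({y. \<bar>y\<bar> > K} \<union> A))"
    proof -
      have "{y. \<bar>y - x\<bar> \<le> 1} \<union> ({y. \<bar>y\<bar> > K} \<union> A) = space M" by (auto simp: A_def)
      then show ?thesis using prob_space by simp
    qed
    also have "\<dots> \<le> prob {y. \<bar>y - x\<bar> \<le> 1} + (prob {y. \<bar>y\<bar> > K} + prob A)"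
      by (intro order_trans[OF measure_Un_le] add_mono order_refl) auto
    finally have "q / 2 \<le> prob A" using conc[of x] tail by simp
    then have "q / 2 * b \<le> prob A * b" using \<open>0 \<le> b\<close> by (rule mult_right_mono)
    also have "\<dots> = (\<integral>y. indicator A y * b \<partial>M)" by simp
    also have "\<dots> \<le> (\<integral>y. ?f x y \<partial>M)"
    proof (rule integral_mono)
      show "integrable M (\<lambda>y. indicator A y * b)"
        using \<open>0 \<le> b\<close> by (intro integrable_const_bound[where B = b]) (auto simp: indicator_def)
      show "integrable M (?f x)" using fB by (intro integrable_const_bound[where B = "2 * real (card J)"]) auto
      fix y show "indicator A y * b \<le> ?f x y"
        using energy[of "x - y"] f0[of x y] x by (auto simp: indicator_def A_def)
    qed
    finally show ?thesis .
  qed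
  have "q / 4 * b \<le> (1 - q / 2) * (q / 2 * b)"
    using mult_right_mono[of "1/2" "1 - q/2" "q / 2 * b"] assms(2-4) by simp
  also have "\<dots> \<le> prob {x. \<bar>x\<bar> \<le> K} * (q / 2 * b)"
  proof (rule mult_right_mono)
    have "{x. \<bar>x\<bar> \<le> K} = space M - {x. \<bar>x\<bar> > K}" by auto
    then have "prob {x. \<bar>x\<bar> \<le> K} = 1 - prob {x. \<bar>x\<bar> > K}" by (simp only:) (rule prob_compl, simp)
    then show "1 - q / 2 \<le> prob {x. \<bar>x\<bar> \<le> K}" using tail by simp
  qed (use assms in simp)
  also have "\<dots> = (\<integral>x. indicator {x. \<bar>x\<bar> \<le> K} x * (q / 2 * b) \<partial>M)" by simp
  also have "\<dots> \<le> (\<integral>x. \<integral>y. ?f x y \<partial>M \<partial>M)"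
  proof (rule integral_mono)
    show "integrable M (\<lambda>x. indicator {x. \<bar>x\<bar> \<le> K} x * (q / 2 * b))"
      using assms by (intro integrable_const_bound[where B = "q / 2 * b"]) (auto simp: indicator_def)
    show "integrable M (\<lambda>x. \<integral>y. ?f x y \<partial>M)" by (rule P.integrable_fst_bounded[OF fm fB])
    fix x show "indicator {x. \<bar>x\<bar> \<le> K} x * (q / 2 * b) \<le> (\<integral>y. ?f x y \<partial>M)"
      using inner[of x] f0 by (auto simp: indicator_def intro!: integral_nonneg)
  qed
  also have "\<dots> = (\<Sum>j\<in>J. 1 - (cmod (char M (s j)))\<^sup>2)"
  proof -
    have m: "(\<lambda>(x, y). cos (s j * (x - y))) \<in> borel_measurable (M \<Otimes>\<^sub>M M)" for j by measurable
    have i1: "integrable M (\<lambda>y. cos (s j * (x - y)))" for j x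
      by (auto intro!: integrable_const_bound[where B = 1])
    have i2: "integrable M (\<lambda>x. \<integral>y. cos (s j * (x - y)) \<partial>M)" for j
      by (rule P.integrable_fst_bounded[OF m, of _ 1]) simp
    have "(\<integral>y. ?f x y \<partial>M) = (\<Sum>j\<in>J. 1 - (\<integral>y. cos (s j * (x - y)) \<partial>M))" for x
      using i1 prob_space by (simp add: Bochner_Integration.integral_sum)
    then show ?thesis
      using i2 prob_space by (simp add: cmod_char_square Bochner_Integration.integral_sum)
  qed
  finally have E: "q / 4 * b \<le> (\<Sum>j\<in>J. 1 - (cmod (char M (s j)))\<^sup>2)" .
  \<comment> \<open>From sums to products by z <= exp(-(1 - z)) with z = |char|^2; the final square
    root halves q/4 to q/8.\<close>
  have "(\<Prod>j\<in>J. cmod (char M (s j)))\<^sup>2 = (\<Prod>j\<in>J. (cmod (char M (s j)))\<^sup>2)"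
    by (simp add: prod_power_distrib)
  also have "\<dots> \<le> (\<Prod>j\<in>J. exp (- (1 - (cmod (char M (s j)))\<^sup>2)))"
  proof (rule prod_mono, intro conjI)
    fix j
    show "(cmod (char M (s j)))\<^sup>2 \<le> exp (- (1 - (cmod (char M (s j)))\<^sup>2))"
      using exp_ge_add_one_self[of "- (1 - (cmod (char M (s j)))\<^sup>2)"] by simp
  qed simp
  also have "\<dots> = exp (- (\<Sum>j\<in>J. 1 - (cmod (char M (s j)))\<^sup>2))"
    using \<open>finite J\<close> by (simp add: exp_sum[symmetric] sum_negf[symmetric])
  also have "\<dots> \<le> exp (- (q / 4 * b))" using E by simp
  also have "\<dots> = (exp (- (q / 8) * b))\<^sup>2" by (simp add: exp_double[symmetric])
  finally show ?thesis by (rule power2_le_imp_le) simp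
qed

text \<open>Witnesses of condition (H) are fixed here; \<open>K\<close> is the constant called M
  there, since \<open>M\<close> names the probability space.\<close>

locale iid_spread = prob_space +
  fixes \<xi> :: "nat \<Rightarrow> 'a \<Rightarrow> real" and K q :: real
  assumes rv [measurable]: "\<And>i. \<xi> i \<in> borel_measurable M"
    and indep: "indep_vars (\<lambda>_. borel) \<xi> UNIV"
    and ident: "\<And>i. distr M borel (\<xi> i) = distr M borel (\<xi> 0)"
    and K: "0 < K" and q: "0 < q" "q < 1"
    and conc: "\<And>u. prob {\<omega> \<in> space M. \<bar>\<xi> 0 \<omega> - u\<bar> \<le> 1} \<le> 1 - q"
    and tail: "prob {\<omega> \<in> space M. \<bar>\<xi> 0 \<omega>\<bar> > K} \<le> q / 2"
begin

text \<open>The left side is the real part of a characteristic function, which independence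
  factorises into values of the common one at the \<open>s j\<close>.\<close>

lemma expectation_cos_sum_le:
  assumes "0 \<le> b"
    and energy: "\<And>\<eta>. 1 \<le> \<bar>\<eta>\<bar> \<Longrightarrow> \<bar>\<eta>\<bar> \<le> 2 * K \<Longrightarrow> b \<le> (\<Sum>j<n. 1 - cos (s j * \<eta>))"
  shows "expectation (\<lambda>\<omega>. cos (\<Sum>j<n. s j * \<xi> j \<omega>)) \<le> exp (- (q / 8) * b)"
proof -
  let ?\<mu> = "distr M borel (\<xi> 0)"
  interpret \<mu>: real_distribution ?\<mu> by (rule real_distribution_distr) simp
  have Z: "(\<lambda>\<omega>. \<Sum>j<n. s j * \<xi> j \<omega>) \<in> borel_measurable M" by measurable
  have ie: "integrable M (\<lambda>\<omega>. iexp (\<Sum>j<n. s j * \<xi> j \<omega>))"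
    by (rule integrable_iexp) (use Z in auto)
  have "char (distr M borel (\<lambda>\<omega>. \<Sum>j<n. s j * \<xi> j \<omega>)) 1 = (\<Prod>j<n. char (distr M borel (\<lambda>\<omega>. s j * \<xi> j \<omega>)) 1)"
  proof (rule char_distr_sum)
    have "indep_vars (\<lambda>_. borel) \<xi> {..<n}" using indep by (rule indep_vars_subset) simp
    then show "indep_vars (\<lambda>_. borel) (\<lambda>j \<omega>. s j * \<xi> j \<omega>) {..<n}"
      by (rule indep_vars_compose2) simp
  qed
  also have "\<dots> = (\<Prod>j<n. char ?\<mu> (s j))"
  proof (intro prod.cong refl)
    fix j
    have "char (distr M borel (\<lambda>\<omega>. s j * \<xi> j \<omega>)) 1 = char (distr M borel (\<xi> j)) (s j)"
      by (simp add: char_def integral_distr)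
    then show "char (distr M borel (\<lambda>\<omega>. s j * \<xi> j \<omega>)) 1 = char ?\<mu> (s j)" by (simp only: ident[of j])
  qed
  finally have ch: "char (distr M borel (\<lambda>\<omega>. \<Sum>j<n. s j * \<xi> j \<omega>)) 1 = (\<Prod>j<n. char ?\<mu> (s j))" .
  have "expectation (\<lambda>\<omega>. cos (\<Sum>j<n. s j * \<xi> j \<omega>)) = Re (char (distr M borel (\<lambda>\<omega>. \<Sum>j<n. s j * \<xi> j \<omega>)) 1)"
    using integral_Re[OF ie] Z by (simp add: char_def integral_distr Re_exp)
  also have "\<dots> \<le> cmod (\<Prod>j<n. char ?\<mu> (s j))" unfolding ch by (rule complex_Re_le_cmod)
  also have "\<dots> = (\<Prod>j<n. cmod (char ?\<mu> (s j)))" by (rule prod_norm[symmetric])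
  also have "\<dots> \<le> exp (- (q / 8) * b)"
  proof (rule \<mu>.prod_char_le[where K = K])
    show "measure ?\<mu> {x. \<bar>x - u\<bar> \<le> 1} \<le> 1 - q" for u
      using conc[of u] by (simp add: measure_distr vimage_def Int_def conj_commute)
    show "measure ?\<mu> {x. \<bar>x\<bar> > K} \<le> q / 2"
      using tail by (simp add: measure_distr vimage_def Int_def conj_commute)
  qed (use assms q in auto)
  finally show ?thesis .
qed

section \<open>Small-ball bounds for the eigenvalues\<close>

lemma measurable_circ_eigenvalue [measurable]:
  "(\<lambda>\<omega>. circ_eigenvalue n (\<lambda>j. \<xi> j \<omega>) k) \<in> borel_measurable M"
  unfolding circ_eigenvalue_def by measurable

text \<open>Smoothing at scale \<open>t\<close> uses |\<theta>| <= 2/t, and symmetrised differences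
  multiply this by at most 2K. So energy bounds are needed up to modulus 4K/t, which is what
  \<open>order\<close> provides.\<close>

lemma small_ball_complex:
  assumes n: "n > 0" and k: "\<not> n dvd 2 * k" and t: "t > 0"
    and order: "4 * K / t \<le> 1 \<or> 2 * pi * (4 * K / t) \<le> real (n div gcd k n)"
  shows "prob {\<omega> \<in> space M. cmod (circ_eigenvalue n (\<lambda>j. \<xi> j \<omega>) k) \<le> t}
    \<le> 4 * (4096 * pi / q * t\<^sup>2 / n + exp (- (q / 4096) * n))"
proof -
  define S where "S = (\<lambda>\<omega>. circ_eigenvalue n (\<lambda>j. \<xi> j \<omega>) k)"
  have [measurable]: "S \<in> borel_measurable M" unfolding S_def by measurable
  let ?X = "\<lambda>\<omega>. Re (S \<omega>) / t" and ?Y = "\<lambda>\<omega>. Im (S \<omega>) / t"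
  let ?a = "q / 4096 * n / t\<^sup>2"
  have "prob {\<omega> \<in> space M. cmod (S \<omega>) \<le> t} \<le> prob {\<omega> \<in> space M. \<bar>?X \<omega>\<bar> \<le> 1 \<and> \<bar>?Y \<omega>\<bar> \<le> 1}"
  proof (rule finite_measure_mono)
    show "{\<omega> \<in> space M. cmod (S \<omega>) \<le> t} \<subseteq> {\<omega> \<in> space M. \<bar>?X \<omega>\<bar> \<le> 1 \<and> \<bar>?Y \<omega>\<bar> \<le> 1}"
      using t order_trans[OF abs_Re_le_cmod] order_trans[OF abs_Im_le_cmod]
      by (auto simp: abs_divide)
  qed measurable
  also have "\<dots> \<le> 4 * (pi / ?a + exp (- (q / 4096) * n))"
  proof (rule small_ball_2d)
    show "0 < ?a" using q n t by simp
    fix u v :: real assume uv: "\<bar>u\<bar> \<le> 1" "\<bar>v\<bar> \<le> 1"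
    \<comment> \<open>The minus sign makes the real part of \<open>\<theta> * S \<omega>\<close>
      equal to the linear form in the real and imaginary parts.\<close>
    define \<theta> where "\<theta> = Complex (u / t) (- v / t)"
    have \<theta>2: "(cmod \<theta>)\<^sup>2 = (u\<^sup>2 + v\<^sup>2) / t\<^sup>2"
      by (simp add: \<theta>_def cmod_power2 power_divide add_divide_distrib)
    have "u\<^sup>2 \<le> 1" "v\<^sup>2 \<le> 1" using uv by (simp_all add: abs_square_le_1)
    then have "(cmod \<theta>)\<^sup>2 \<le> (2 / t)\<^sup>2"
      unfolding \<theta>2 power_divide using t by (intro divide_right_mono) auto
    then have \<theta>: "cmod \<theta> \<le> 2 / t" by (rule power2_le_imp_le) (use t in simp)
    define s where "s = (\<lambda>j. Re (\<theta> * unity_root n (j * k)))"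
    let ?b = "real n / 512 * min 1 ((cmod \<theta>)\<^sup>2)"
    have eq: "u * ?X \<omega> + v * ?Y \<omega> = (\<Sum>j<n. s j * \<xi> j \<omega>)" for \<omega>
    proof -
      have "u * ?X \<omega> + v * ?Y \<omega> = Re (\<theta> * S \<omega>)"
        by (simp add: \<theta>_def)
      also have "\<theta> * S \<omega> = (\<Sum>j<n. of_real (\<xi> j \<omega>) * (\<theta> * unity_root n (j * k)))"
        by (simp add: S_def circ_eigenvalue_def sum_distrib_left mult_ac)
      also have "Re \<dots> = (\<Sum>j<n. s j * \<xi> j \<omega>)"
        by (simp add: s_def algebra_simps)
      finally show ?thesis .
    qed
    have "expectation (\<lambda>\<omega>. cos (u * ?X \<omega> + v * ?Y \<omega>)) \<le> exp (- (q / 8) * ?b)"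
      unfolding eq
    proof (rule expectation_cos_sum_le)
      fix \<eta> :: real assume \<eta>: "1 \<le> \<bar>\<eta>\<bar>" "\<bar>\<eta>\<bar> \<le> 2 * K"
      define \<theta>' where "\<theta>' = of_real \<eta> * \<theta>"
      have n': "cmod \<theta>' = \<bar>\<eta>\<bar> * cmod \<theta>" by (simp add: \<theta>'_def norm_mult)
      have le: "cmod \<theta> \<le> cmod \<theta>'" unfolding n' using \<eta> mult_right_mono[of 1 "\<bar>\<eta>\<bar>" "cmod \<theta>"] by simp
      have ub: "cmod \<theta>' \<le> 4 * K / t"
        unfolding n' using mult_mono[OF \<eta>(2) \<theta>] K t by simp
      have "(\<Sum>j<n. 1 - cos (s j * \<eta>)) = phase_energy n k \<theta>'"
        unfolding phase_energy_def s_def \<theta>'_def by (simp add: algebra_simps)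
      moreover have "real n / 512 * min 1 ((cmod \<theta>')\<^sup>2) \<le> phase_energy n k \<theta>'"
        using order
      proof
        assume "4 * K / t \<le> 1"
        then have "cmod \<theta>' \<le> 1" using ub by simp
        from phase_energy_small[OF n k this]
        have "real n / 8 * (cmod \<theta>')\<^sup>2 \<le> phase_energy n k \<theta>'" by simp
        moreover have "real n / 512 * min 1 ((cmod \<theta>')\<^sup>2) \<le> real n / 8 * (cmod \<theta>')\<^sup>2"
          by (intro mult_mono) auto
        ultimately show ?thesis by simp
      next
        assume "2 * pi * (4 * K / t) \<le> real (n div gcd k n)"
        moreover have "2 * pi * cmod \<theta>' \<le> 2 * pi * (4 * K / t)"
          using ub by (intro mult_left_mono) auto
        ultimately show ?thesis by (intro phase_energy_ge n k) simp
      qed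
      \<comment> \<open>Since |\<eta>| >= 1, scaling by \<eta> only increases the modulus, so a
        bound independent of \<eta> remains; here 4096 = 8 * 512.\<close>
      moreover have "?b \<le> real n / 512 * min 1 ((cmod \<theta>')\<^sup>2)"
        using power_mono[OF le, of 2] by (intro mult_left_mono min.mono) auto
      ultimately show "?b \<le> (\<Sum>j<n. 1 - cos (s j * \<eta>))" by simp
    qed simp
    also have "\<dots> \<le> exp (- ?a * (u\<^sup>2 + v\<^sup>2)) + exp (- (q / 4096) * n)"
    \<comment> \<open>For |\<theta>| <= 1 the Gaussian term is matched exactly; beyond that the
      minimum saturates at 1 and the second exponential takes over.\<close>
    proof (cases "(cmod \<theta>)\<^sup>2 \<le> 1")
      case True
      then have "- (q / 8) * ?b = - ?a * (u\<^sup>2 + v\<^sup>2)" by (simp add: \<theta>2 min_def)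
      then show ?thesis by simp
    next
      case False
      then have "min 1 ((cmod \<theta>)\<^sup>2) = 1" by simp
      then show ?thesis by simp
    qed
    finally show "expectation (\<lambda>\<omega>. cos (u * ?X \<omega> + v * ?Y \<omega>)) \<le> exp (- ?a * (u\<^sup>2 + v\<^sup>2)) + exp (- (q / 4096) * n)" .
  qed measurable
  also have "pi / ?a = 4096 * pi / q * t\<^sup>2 / n" using t q n by (simp add: field_simps)
  finally show ?thesis by (simp add: S_def)
qed

text \<open>Here every root occurring is 1 or -1, so the sum is real and one-dimensional smoothing
  is used. The condition \<open>2 * K \<le> t\<close> keeps all phases in [-1, 1], where the
  quadratic cosine bound holds.\<close>

lemma small_ball_real:
  assumes n: "n > 0" and k: "n dvd 2 * k" and t: "2 * K \<le> t"
  shows "prob {\<omega> \<in> space M. cmod (circ_eigenvalue n (\<lambda>j. \<xi> j \<omega>) k) \<le> t}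
    \<le> 2 * sqrt (32 * pi * t\<^sup>2 / (q * n))"
proof -
  have t0: "t > 0" using t K by simp
  define S where "S = (\<lambda>\<omega>. circ_eigenvalue n (\<lambda>j. \<xi> j \<omega>) k)"
  have [measurable]: "S \<in> borel_measurable M" unfolding S_def by measurable
  let ?X = "\<lambda>\<omega>. Re (S \<omega>) / t"
  let ?a = "q * n / (32 * t\<^sup>2)"
  have "prob {\<omega> \<in> space M. cmod (S \<omega>) \<le> t} \<le> prob {\<omega> \<in> space M. \<bar>?X \<omega>\<bar> \<le> 1}"
  proof (rule finite_measure_mono)
    show "{\<omega> \<in> space M. cmod (S \<omega>) \<le> t} \<subseteq> {\<omega> \<in> space M. \<bar>?X \<omega>\<bar> \<le> 1}"
      using t0 order_trans[OF abs_Re_le_cmod] by (auto simp: abs_divide)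
  qed measurable
  also have "\<dots> \<le> 2 * sqrt (pi / ?a)"
  proof (rule small_ball_1d)
    show "0 < ?a" using q n t0 by simp
    fix u :: real assume u: "\<bar>u\<bar> \<le> 1"
    define s where "s = (\<lambda>j. u / t * Re (unity_root n (j * k)))"
    have abs: "\<bar>Re (unity_root n (j * k))\<bar> = 1" for j
    proof -
      have "unity_root n (j * k) ^ 2 = unity_root n (j * (2 * k))"
        by (simp add: mult_ac flip: unity_root_mult)
      also have "\<dots> = 1" using k n by (simp add: unity_root_eq_1_iff)
      finally show ?thesis by (auto simp: power2_eq_1_iff)
    qed
    have "expectation (\<lambda>\<omega>. cos (\<Sum>j<n. s j * \<xi> j \<omega>)) \<le> exp (- (q / 8) * (n * u\<^sup>2 / (4 * t\<^sup>2)))"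
    proof (rule expectation_cos_sum_le)
      fix \<eta> :: real assume \<eta>: "1 \<le> \<bar>\<eta>\<bar>" "\<bar>\<eta>\<bar> \<le> 2 * K"
      have term_ge: "u\<^sup>2 / (4 * t\<^sup>2) \<le> 1 - cos (s j * \<eta>)" for j
      proof -
        have sj: "\<bar>s j * \<eta>\<bar> = \<bar>u\<bar> * (\<bar>\<eta>\<bar> / t)" using t0 by (simp add: s_def abs_mult abs)
        have "\<bar>u\<bar> * (\<bar>\<eta>\<bar> / t) \<le> 1 * 1" using u \<eta> t t0 by (intro mult_mono) auto
        then have "(s j * \<eta>)\<^sup>2 / 4 \<le> 1 - cos (s j * \<eta>)" using sj by (intro one_minus_cos_ge) simp
        moreover have "(u / t)\<^sup>2 \<le> (s j * \<eta>)\<^sup>2"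
        proof -
          have "\<bar>u / t\<bar> \<le> \<bar>s j * \<eta>\<bar>"
            unfolding sj using t0 \<eta> mult_left_mono[of 1 "\<bar>\<eta>\<bar>" "\<bar>u\<bar>"] by (simp add: divide_right_mono)
          then show ?thesis by (simp only: abs_le_square_iff)
        qed
        ultimately show ?thesis by (simp add: power_divide)
      qed
      have "n * u\<^sup>2 / (4 * t\<^sup>2) = (\<Sum>j<n. u\<^sup>2 / (4 * t\<^sup>2))" by simp
      also have "\<dots> \<le> (\<Sum>j<n. 1 - cos (s j * \<eta>))" by (intro sum_mono term_ge)
      finally show "n * u\<^sup>2 / (4 * t\<^sup>2) \<le> (\<Sum>j<n. 1 - cos (s j * \<eta>))" .
    qed simp
    moreover have "u * ?X \<omega> = (\<Sum>j<n. s j * \<xi> j \<omega>)" for \<omega>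
      by (simp add: S_def s_def circ_eigenvalue_def sum_distrib_left sum_divide_distrib mult_ac)
    ultimately show "expectation (\<lambda>\<omega>. cos (u * ?X \<omega>)) \<le> exp (- ?a * u\<^sup>2)"
      by (simp add: mult_ac)
  qed measurable
  also have "pi / ?a = 32 * pi * t\<^sup>2 / (q * n)" using t0 q n by (simp add: field_simps)
  finally show ?thesis by (simp add: S_def)
qed

end

section \<open>Union bound over all eigenvalues\<close>

context iid_spread
begin

text \<open>Three classes of \<open>k\<close>: at most 2 real ones cost \<open>A1 / sqrt n\<close>
  each, at most \<open>sqrt n\<close> of small order cost \<open>A2 / n\<close> each, and the rest
  cost \<open>A3 * t\<^sup>2 / n\<close> each.\<close>

lemma prob_sigma_min_le:
  assumes n: "n > 0" and t: "0 < t" "t \<le> 4 * K"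
    and order: "2 * pi * (4 * K / t) \<le> real n powr (1/4)"
    and ex: "exp (- (q / 4096) * n) \<le> 1 / n" "exp (- (q / 4096) * n) \<le> t\<^sup>2 / n"
  shows "prob {\<omega> \<in> space M. sigma_min n (circulant n (\<lambda>k. \<xi> k \<omega>)) \<le> t}
    \<le> (4 * sqrt (32 * pi * (4 * K)\<^sup>2 / q) + 4 * (4096 * pi / q * (4 * K)\<^sup>2 + 1)) / sqrt n
      + 4 * (4096 * pi / q + 1) * t\<^sup>2"
proof -
  define A1 A2 A3 D where "A1 = 2 * sqrt (32 * pi * (4 * K)\<^sup>2 / q)"
    and "A2 = 4 * (4096 * pi / q * (4 * K)\<^sup>2 + 1)" and "A3 = 4 * (4096 * pi / q + 1)"
    and "D = nat \<lfloor>real n powr (1/4)\<rfloor>"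
  have A0: "A1 \<ge> 0" "A2 \<ge> 0" "A3 \<ge> 0" using q by (auto simp: A1_def A2_def A3_def)
  let ?E = "\<lambda>k. {\<omega> \<in> space M. cmod (circ_eigenvalue n (\<lambda>j. \<xi> j \<omega>) k) \<le> t}"
  let ?E' = "\<lambda>k. {\<omega> \<in> space M. cmod (circ_eigenvalue n (\<lambda>j. \<xi> j \<omega>) k) \<le> 4 * K}"
  let ?R = "{k. k < n \<and> n dvd 2 * k}" and ?S = "{k. k < n \<and> n div gcd k n \<le> D}"
  have [measurable]: "?E k \<in> sets M" "?E' k \<in> sets M" for k by measurable
  \<comment> \<open>For the first two classes the radius is enlarged to \<open>4 * K\<close>, where
    the small-ball lemmas apply irrespective of the order.\<close>
  have EE': "prob (?E k) \<le> prob (?E' k)" for k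
    using t by (intro finite_measure_mono) auto
  have single: "prob (?E k) \<le> indicator ?R k * (A1 / sqrt n) + indicator ?S k * (A2 / n) + A3 * t\<^sup>2 / n"
    if k: "k < n" for k
  proof -
    consider "n dvd 2 * k" | "\<not> n dvd 2 * k" "n div gcd k n \<le> D" | "\<not> n dvd 2 * k" "D < n div gcd k n"
      by linarith
    then show ?thesis
    proof cases
      case 1
      have "prob (?E k) \<le> 2 * sqrt (32 * pi * (4 * K)\<^sup>2 / (q * n))"
        using small_ball_real[OF n 1, of "4 * K"] EE'[of k] K by linarith
      also have "\<dots> = A1 / sqrt n" by (simp add: A1_def real_sqrt_divide real_sqrt_mult)
      finally have "prob (?E k) \<le> A1 / sqrt n" .
      moreover have "indicator ?R k = (1::real)" using 1 k by simp
      moreover have "0 \<le> indicator ?S k * (A2 / n) + A3 * t\<^sup>2 / n" using A0 by simp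
      ultimately show ?thesis by simp
    next
      case 2
      have "prob (?E k) \<le> 4 * (4096 * pi / q * (4 * K)\<^sup>2 / n + exp (- (q / 4096) * n))"
        using small_ball_complex[OF n 2(1), of "4 * K"] EE'[of k] K by simp
      also have "\<dots> \<le> 4 * (4096 * pi / q * (4 * K)\<^sup>2 / n + 1 / n)" using ex(1) by simp
      also have "\<dots> = A2 / n" by (simp add: A2_def add_divide_distrib)
      finally have "prob (?E k) \<le> A2 / n" .
      moreover have "indicator ?S k = (1::real)" using 2 k by simp
      moreover have "0 \<le> indicator ?R k * (A1 / sqrt n) + A3 * t\<^sup>2 / n" using A0 by simp
      ultimately show ?thesis by simp
    next
      case 3
      \<comment> \<open>\<open>D\<close> is rounded down, so an integer above \<open>D\<close> is at
        least the fourth root itself.\<close>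
      have "real n powr (1/4) \<le> real (n div gcd k n)" using 3(2) unfolding D_def by linarith
      then have "prob (?E k) \<le> 4 * (4096 * pi / q * t\<^sup>2 / n + exp (- (q / 4096) * n))"
        using order by (intro small_ball_complex n 3 t) auto
      also have "\<dots> \<le> 4 * (4096 * pi / q * t\<^sup>2 / n + t\<^sup>2 / n)" using ex(2) by simp
      also have "\<dots> = A3 * t\<^sup>2 / n" by (simp add: A3_def add_divide_distrib distrib_right)
      finally have "prob (?E k) \<le> A3 * t\<^sup>2 / n" .
      moreover have "0 \<le> indicator ?R k * (A1 / sqrt n) + indicator ?S k * (A2 / n)" using A0 by simp
      ultimately show ?thesis by simp
    qed
  qed
  have "prob {\<omega> \<in> space M. sigma_min n (circulant n (\<lambda>k. \<xi> k \<omega>)) \<le> t} \<le> prob (\<Union>k<n. ?E k)"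
    using sigma_min_circulant_le_imp[OF n] by (intro finite_measure_mono) auto
  also have "\<dots> \<le> (\<Sum>k<n. prob (?E k))"
    by (intro measure_UNION_le) auto
  also have "\<dots> \<le> (\<Sum>k<n. indicator ?R k * (A1 / sqrt n) + indicator ?S k * (A2 / n) + A3 * t\<^sup>2 / n)"
    by (intro sum_mono single) simp
  also have "\<dots> = card ?R * (A1 / sqrt n) + card ?S * (A2 / n) + A3 * t\<^sup>2"
  proof -
    have "(\<Sum>k<n. indicator {k. k < n \<and> Q k} k :: real) = card {k. k < n \<and> Q k}" for Q
    proof -
      have "{..<n} \<inter> {k. k < n \<and> Q k} = {k. k < n \<and> Q k}" by auto
      then show ?thesis unfolding indicator_def of_bool_def by (subst sum.If_cases) auto
    qed
    then show ?thesis using n by (simp only: sum.distrib sum_distrib_right[symmetric]) simp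
  qed
  also have "\<dots> \<le> 2 * (A1 / sqrt n) + sqrt n * (A2 / n) + A3 * t\<^sup>2"
  proof (intro add_mono mult_right_mono order_refl)
    show "real (card ?R) \<le> 2" using card_dvd_double_le[OF n] by linarith
    have "real (card ?S) \<le> (real D)\<^sup>2" using card_small_order_le[OF n, of D] by (simp flip: of_nat_power)
    also have "\<dots> \<le> (real n powr (1/4))\<^sup>2"
      unfolding D_def by (intro power_mono) auto
    also have "\<dots> = sqrt n" using n by (simp add: powr_power powr_half_sqrt)
    finally show "real (card ?S) \<le> sqrt n" .
  qed (use A0 in auto)
  also have "sqrt n * (A2 / n) = A2 / sqrt n"
    using n by (simp add: field_simps real_sqrt_mult_self flip: real_sqrt_mult)
  finally show ?thesis by (simp add: A1_def A2_def A3_def add_divide_distrib)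
qed

end

theorem mainTheorem4:
  fixes M :: "'a measure" and \<xi> :: "nat \<Rightarrow> 'a \<Rightarrow> real"
  assumes "prob_space M"
    and rv: "\<And>i. \<xi> i \<in> borel_measurable M"
    and indep: "prob_space.indep_vars M (\<lambda>_. borel) \<xi> UNIV"
    and ident: "\<And>i. distr M borel (\<xi> i) = distr M borel (\<xi> 0)"
    and H: "\<exists>K>0. \<exists>q. 0 < q \<and> q < 1 \<and>
              (\<forall>u. measure M {\<omega> \<in> space M. \<bar>\<xi> 0 \<omega> - u\<bar> \<le> 1} \<le> 1 - q) \<and>
              measure M {\<omega> \<in> space M. \<bar>\<xi> 0 \<omega>\<bar> > K} \<le> q / 2"
  shows "\<exists>C>0. \<exists>\<delta> :: nat \<Rightarrow> real. \<delta> \<longlonglongrightarrow> 0 \<and>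
           (\<forall>\<epsilon>>0. \<forall>\<rho>. 0 < \<rho> \<and> \<rho> < 1/4 \<longrightarrow>
              (\<forall>\<^sub>F n in sequentially.
                 measure M {\<omega> \<in> space M.
                    sigma_min n (circulant n (\<lambda>k. \<xi> k \<omega>)) \<le> \<epsilon> * real n powr (-\<rho>)}
                 \<le> C * ((\<epsilon>^2 + \<epsilon>) / real n powr (2 * \<rho>) + 1 / real n powr (1/2 - \<delta> n))))"
proof -
  obtain K q where Kq: "K > 0" "0 < q" "q < 1"
    "\<And>u. measure M {\<omega> \<in> space M. \<bar>\<xi> 0 \<omega> - u\<bar> \<le> 1} \<le> 1 - q"
    "measure M {\<omega> \<in> space M. \<bar>\<xi> 0 \<omega>\<bar> > K} \<le> q / 2"
    using H by blast
  interpret iid_spread M \<xi> K q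
    by (intro iid_spread.intro iid_spread_axioms.intro assms Kq)
  define B1 B2 where "B1 = 4 * sqrt (32 * pi * (4 * K)\<^sup>2 / q) + 4 * (4096 * pi / q * (4 * K)\<^sup>2 + 1)"
    and "B2 = 4 * (4096 * pi / q + 1)"
  have B: "B1 > 0" "B2 > 0"
    using Kq by (auto simp: B1_def B2_def intro!: add_nonneg_pos mult_pos_pos)
  show ?thesis
  \<comment> \<open>\<open>B1\<close> and \<open>B2\<close> depend only on \<open>K\<close> and
    \<open>q\<close>, so the constant is fixed before \<epsilon> and \<rho>.\<close>
  proof (intro exI[of _ "B1 + B2"] conjI exI[of _ "\<lambda>_. 0"] allI impI)
    fix \<epsilon> \<rho> :: real assume \<epsilon>: "\<epsilon> > 0" and \<rho>: "0 < \<rho> \<and> \<rho> < 1/4"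
    have "\<forall>\<^sub>F n in sequentially. \<epsilon> * real n powr (-\<rho>) \<le> 4 * K"
      using \<rho> Kq \<epsilon> by real_asymp
    \<comment> \<open>This is where \<rho> < 1/4 enters: orders above the fourth root of
      \<open>n\<close> suffice at scale \<open>\<epsilon> * real n powr (-\<rho>)\<close>.\<close>
    moreover have "\<forall>\<^sub>F n in sequentially. 2 * pi * (4 * K / \<epsilon>) * real n powr \<rho> \<le> real n powr (1/4)"
      using \<rho> by real_asymp
    moreover have "\<forall>\<^sub>F n in sequentially. exp (- (q / 4096) * real n) \<le> 1 / real n"
      using Kq by real_asymp
    moreover have "\<forall>\<^sub>F n in sequentially. exp (- (q / 4096) * real n) \<le> (\<epsilon> * real n powr (-\<rho>))\<^sup>2 / real n"
      using Kq \<epsilon> by real_asymp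
    ultimately show "\<forall>\<^sub>F n in sequentially.
                 measure M {\<omega> \<in> space M.
                    sigma_min n (circulant n (\<lambda>k. \<xi> k \<omega>)) \<le> \<epsilon> * real n powr (-\<rho>)}
                 \<le> (B1 + B2) * ((\<epsilon>^2 + \<epsilon>) / real n powr (2 * \<rho>) + 1 / real n powr (1/2 - 0))"
      using eventually_gt_at_top[of 0]
    proof eventually_elim
      case (elim n)
      let ?t = "\<epsilon> * real n powr (-\<rho>)"
      have "prob {\<omega> \<in> space M. sigma_min n (circulant n (\<lambda>k. \<xi> k \<omega>)) \<le> ?t} \<le> B1 / sqrt n + B2 * ?t\<^sup>2"
        unfolding B1_def B2_def
      proof (rule prob_sigma_min_le)
        show "2 * pi * (4 * K / ?t) \<le> real n powr (1/4)"
          using elim(2) by (simp add: powr_minus field_simps)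
      qed (use elim \<epsilon> in auto)
      also have "?t\<^sup>2 = \<epsilon>\<^sup>2 / real n powr (2 * \<rho>)"
        using elim by (simp add: power_mult_distrib powr_minus powr_power power_divide field_simps)
      also have "B1 / sqrt n + B2 * (\<epsilon>\<^sup>2 / real n powr (2 * \<rho>))
          \<le> (B1 + B2) * (1 / sqrt n) + (B1 + B2) * ((\<epsilon>\<^sup>2 + \<epsilon>) / real n powr (2 * \<rho>))"
      proof (rule add_mono)
        show "B1 / sqrt n \<le> (B1 + B2) * (1 / sqrt n)" using B by (simp add: divide_right_mono)
        show "B2 * (\<epsilon>\<^sup>2 / real n powr (2 * \<rho>)) \<le> (B1 + B2) * ((\<epsilon>\<^sup>2 + \<epsilon>) / real n powr (2 * \<rho>))"
          using B \<epsilon> by (intro mult_mono divide_right_mono) auto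
      qed
      finally show ?case by (simp add: powr_half_sqrt distrib_left add.commute)
    qed
  qed (use B in auto)
qed

end
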